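(* Let $0\le\alpha\le 1$, and let $\mathcal{B}=\{b_n\}_{n=1}^\infty$ and $\mathcal{D}=\{d_n\}_{n=1}^\infty$ be sequences of positive integers such that $1<d_n<b_n$ for all $n\ge 1$, $$\lim_{n\to\infty}d_n=+\infty\quad\text{and}\quad \lim_{n\to\infty}\frac{\ln d_n}{\ln b_n}=\alpha.$$ Then the Riesz product measure $\mu_{\mathcal{B},\mathcal{D}}$ has Hausdorff dimension $\alpha$, i.e. $\dim_H(\mu_{\mathcal{B},\mathcal{D}})=\alpha$.
   Context: Set $\rho_1:=1$ and $\rho_n:=\prod_{j=1}^{n-1}b_j$ for $n\ge 2$. The Fourier transform of a probability measure $\mu$ on $\mathbb{R}$ is $\hat\mu(\xi):=\int_{\mathbb{R}}e^{-2\pi i\xi x}\,d\mu(x)$. For $m\ge 1$ let $H_m(\xi):=\frac1m\sum_{j=0}^{m-1}e^{-2\pi i j\xi}$. The Riesz product measure $\mu_{\mathcal{B},\mathcal{D}}$ is the compactly supported probability measure on $\mathbb{R}$ defined by $$\widehat{\mu_{\mathcal{B},\mathcal{D}}}(\xi)=\prod_{n=1}^\infty H_{d_n}\Big(\frac{\xi}{d_n\rho_n}\Big).$$ The Hausdorff dimension of a probability measure $\mu$ is $\dim_H(\mu):=\inf\{\dim_H(E):\mu(E)=1\}$, where $\dim_H(E)$ is the Hausdorff dimension of the set $E$. *)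

theory Defs
  imports "HOL-Probability.Probability"
begin

definition rho :: "(nat \<Rightarrow> nat) \<Rightarrow> nat \<Rightarrow> nat" where
  "rho b n = (\<Prod>j=1..<n. b j)"

definition H :: "nat \<Rightarrow> real \<Rightarrow> complex" where
  "H m \<xi> = (1 / of_nat m) * (\<Sum>j<m. exp (- (2 * of_real pi * \<i> * of_nat j * of_real \<xi>)))"

(* The normalisation differs from the library's characteristic function (char). *)
definition fourier :: "real measure \<Rightarrow> real \<Rightarrow> complex" where
  "fourier \<mu> \<xi> = (\<integral>x. exp (- (2 * of_real pi * \<i> * of_real \<xi> * of_real x)) \<partial>\<mu>)"

(* Sequences are indexed from 1, so b 0 and d 0 play no role.  The predicate has_prod is the
   library's convergence of infinite products, in which finitely many factors may vanish. *)
definition is_riesz_product :: "(nat \<Rightarrow> nat) \<Rightarrow> (nat \<Rightarrow> nat) \<Rightarrow> real measure \<Rightarrow> bool" where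
  "is_riesz_product b d \<mu> \<longleftrightarrow>
     prob_space \<mu> \<and> sets \<mu> = sets borel \<and>
     (\<exists>K. compact K \<and> emeasure \<mu> K = 1) \<and>
     (\<forall>\<xi>. (\<lambda>n. H (d (Suc n)) (\<xi> / (real (d (Suc n)) * real (rho b (Suc n)))))
            has_prod fourier \<mu> \<xi>)"

(* The measure is determined by its Fourier transform; existence, as the law of a random series,
   holds when 1 < d n < b n for all n \<ge> 1.  The term is unspecified where no such measure exists. *)
definition riesz_product :: "(nat \<Rightarrow> nat) \<Rightarrow> (nat \<Rightarrow> nat) \<Rightarrow> real measure" where
  "riesz_product b d = (THE \<mu>. is_riesz_product b d \<mu>)"

(* diam U ^ s, with the conventions 0 ^ 0 = 1 for nonempty U (so that the 0-dimensional measure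
   counts points; powr alone would give 0 powr 0 = 0) and value 0 for the empty set.
   Only used for bounded U, since diameter is unspecified otherwise. *)
definition diam_pow :: "real \<Rightarrow> 'a::metric_space set \<Rightarrow> ennreal" where
  "diam_pow s U = (if U = {} then 0 else if s = 0 then 1 else ennreal (diameter U powr s))"

definition hausdorff_pre :: "real \<Rightarrow> real \<Rightarrow> 'a::metric_space set \<Rightarrow> ennreal" where
  "hausdorff_pre s \<delta> E =
     Inf {(\<Sum>i. diam_pow s (U i)) | U :: nat \<Rightarrow> 'a set.
            E \<subseteq> (\<Union>i. U i) \<and> (\<forall>i. bounded (U i) \<and> diameter (U i) \<le> \<delta>)}"

definition hausdorff_measure :: "real \<Rightarrow> 'a::metric_space set \<Rightarrow> ennreal" where
  "hausdorff_measure s E = (SUP \<delta>\<in>{0<..}. hausdorff_pre s \<delta> E)"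

definition dim_H :: "'a::metric_space set \<Rightarrow> ereal" where
  "dim_H E = Inf {ereal s | s. 0 \<le> s \<and> hausdorff_measure s E = 0}"

(* E ranges over measurable sets. *)
definition dim_H_measure :: "'a::metric_space measure \<Rightarrow> ereal" where
  "dim_H_measure \<mu> = Inf {dim_H E | E. E \<in> sets \<mu> \<and> emeasure \<mu> E = 1}"

end

theory Submission
  imports Defs
begin

text \<open>
  The measure is the law of a random series \<open>X = (\<Sum>n. J n / (d (n+1) * scale n))\<close> with independent
  digits \<open>J n\<close>, uniform on \<open>{0,...,d (n+1) - 1}\<close>, where \<open>scale n = b 1 * ... * b n\<close>: the
  factors of the infinite product are the Fourier transforms of the summands. Levy's uniqueness
  theorem identifies this law with \<open>riesz_product b d\<close> (\<open>riesz_product_eq_law\<close>). Since \<open>b j > 2\<close>, what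
  remains of the series after \<open>n\<close> digits lies in \<open>[0, 2 / scale n]\<close>.

  Dimension at most \<open>\<alpha>\<close>: there are at most \<open>words n = d 1 * ... * d n\<close> partial sums of length
  \<open>n\<close>, so \<open>X\<close> lives on a closed set that \<open>words n\<close> intervals of length \<open>2 / scale n\<close> cover.
  For \<open>s > \<alpha>\<close> the sum \<open>words n * (2 / scale n) powr s\<close> is \<open>2 powr s\<close> times the product of the
  factors \<open>d j / b j powr s\<close>, and these tend to 0 (\<open>support_null\<close>).

  Dimension at least \<open>\<alpha>\<close>: by the mass distribution principle it suffices that for each
  \<open>s < \<alpha>\<close> a ball of radius \<open>t\<close> has mass \<open>O(t powr s)\<close>. As \<open>d n\<close> need not divide \<open>b n\<close>,
  cylinders of one generation may overlap, so a short interval can contain several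
  partial sums. However, passing from generation \<open>n\<close> to \<open>n + 1\<close> multiplies the overlap by a
  constant only (\<open>partial_law_step\<close>), which gives mass at most \<open>6 ^ n / words n\<close> to intervals of
  length \<open>5 / scale n\<close> (\<open>partial_law_concentration\<close>). The exponential loss is harmless: because
  \<open>ln (d j) / ln (b j)\<close> tends to \<open>\<alpha> > s\<close> and \<open>b j\<close> to infinity, the factors \<open>6 * b j powr s / d j\<close> of
  \<open>6 ^ n * scale n powr s / words n\<close> are eventually at most 1, so this product is bounded.
  Radii between two consecutive scales are handled by a single application of the
  one-step estimate (\<open>law_ball_bound\<close>, \<open>law_Frostman\<close>).\<close>

section \<open>Hausdorff measure: finite covers and the mass distribution principle\<close>

lemma diam_pow_empty [simp]: "diam_pow s {} = 0"
  by (simp add: diam_pow_def)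

lemma hausdorff_pre_le_finite_cover:
  fixes V :: "'b \<Rightarrow> 'a::metric_space set"
  assumes fin: "finite A" and cov: "E \<subseteq> (\<Union>a\<in>A. V a)" and "0 \<le> \<delta>"
    and V: "\<And>a. a \<in> A \<Longrightarrow> bounded (V a) \<and> diameter (V a) \<le> \<delta>"
  shows "hausdorff_pre s \<delta> E \<le> (\<Sum>a\<in>A. diam_pow s (V a))"
proof -
  obtain h where h: "bij_betw h {0..<card A} A"
    using ex_bij_betw_nat_finite[OF fin] by blast
  define U where "U i = (if i < card A then V (h i) else {})" for i
  have hA: "h i \<in> A" if "i < card A" for i
    using bij_betwE[OF h] that by auto
  have "E \<subseteq> (\<Union>i. U i)"
  proof
    fix x assume "x \<in> E"
    then obtain a where "a \<in> A" "x \<in> V a" using cov by blast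
    moreover from \<open>a \<in> A\<close> obtain i where "i < card A" "h i = a"
      using bij_betw_imp_surj_on[OF h] by force
    ultimately show "x \<in> (\<Union>i. U i)" by (auto simp: U_def intro!: exI[of _ i])
  qed
  moreover have "\<forall>i. bounded (U i) \<and> diameter (U i) \<le> \<delta>"
    using V hA \<open>0 \<le> \<delta>\<close> by (auto simp: U_def)
  ultimately have "hausdorff_pre s \<delta> E \<le> (\<Sum>i. diam_pow s (U i))"
    unfolding hausdorff_pre_def by (intro Inf_lower) blast
  also have "\<dots> = (\<Sum>i<card A. diam_pow s (U i))"
    by (rule suminf_finite) (auto simp: U_def)
  also have "\<dots> = (\<Sum>i\<in>{0..<card A}. diam_pow s (V (h i)))"
    by (rule sum.cong) (auto simp: U_def)
  also have "\<dots> = (\<Sum>a\<in>A. diam_pow s (V a))"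
    by (rule sum.reindex_bij_betw[OF h])
  finally show ?thesis .
qed

text \<open>
  A bounded set lies in the ball around any of its points whose radius is the diameter. Two
  degenerate cases need care: for \<open>s = 0\<close> a slightly larger radius is taken, so that the
  ball estimate applies even to a single point, and for \<open>s > 0\<close> a point has mass 0,
  as the limit of the ball estimates.\<close>
lemma diam_pow_dominates_mass:
  fixes \<mu> :: "'a::metric_space measure"
  assumes sets: "sets \<mu> = sets borel" and "0 \<le> s" "0 \<le> C"
    and ball: "\<And>x t. 0 < t \<Longrightarrow> t < 1 \<Longrightarrow> emeasure \<mu> (cball x t) \<le> ennreal (C * t powr s)"
    and U: "bounded U" "diameter U < 1"
  obtains V where "V \<in> sets \<mu>" "U \<subseteq> V" "emeasure \<mu> V \<le> ennreal C * diam_pow s U"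
proof (cases "U = {}")
  case True
  then show ?thesis by (intro that[of "{}"]) auto
next
  case False
  then obtain x where x: "x \<in> U" by blast
  have sub: "U \<subseteq> cball x (diameter U)"
    using diameter_bounded_bound[OF U(1) x] by auto
  have cb: "cball x t \<in> sets \<mu>" for t by (simp add: sets)
  have "0 \<le> diameter U" by (rule diameter_ge_0[OF U(1)])
  then consider "s = 0" | "0 < s" "0 < diameter U" | "0 < s" "diameter U = 0"
    using \<open>0 \<le> s\<close> by linarith
  then show ?thesis
  proof cases
    case 1
    obtain t where t: "diameter U < t" "t < 1" using dense[OF U(2)] by blast
    with \<open>0 \<le> diameter U\<close> have t0: "0 < t" by linarith
    have "emeasure \<mu> (cball x t) \<le> ennreal C * diam_pow s U"
      using ball[OF t0 t(2), of x] False 1 t0 by (simp add: diam_pow_def)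
    moreover have "U \<subseteq> cball x t" using sub t(1) by force
    ultimately show ?thesis using cb that by blast
  next
    case 2
    have "emeasure \<mu> (cball x (diameter U)) \<le> ennreal C * diam_pow s U"
      using ball[OF 2(2) U(2), of x] False 2 \<open>0 \<le> C\<close> by (simp add: diam_pow_def ennreal_mult)
    then show ?thesis using cb sub that by blast
  next
    case 3
    have "emeasure \<mu> {x} \<le> ennreal (C * t powr s)" if "0 < t" "t < 1" for t
    proof (rule order_trans[OF emeasure_mono ball[OF that]])
      show "{x} \<subseteq> cball x t" using that by simp
    qed (rule cb)
    then have "eventually (\<lambda>t. emeasure \<mu> {x} \<le> ennreal (C * t powr s)) (at_right 0)"
      by (intro eventually_at_rightI[of _ 1]) auto
    moreover have "((\<lambda>t. ennreal (C * t powr s)) \<longlongrightarrow> ennreal (C * 0)) (at_right 0)"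
    proof (intro tendsto_ennrealI tendsto_mult tendsto_const)
      have "((\<lambda>t. t powr s) \<longlongrightarrow> 0 powr s) (at_right 0)"
        using \<open>0 < s\<close> eventually_at_right_less[of "0::real"]
        by (intro tendsto_powr2 tendsto_const tendsto_ident_at) (auto elim: eventually_mono)
      then show "((\<lambda>t. t powr s) \<longlongrightarrow> 0) (at_right (0::real))" by simp
    qed
    ultimately have "emeasure \<mu> {x} \<le> ennreal (C * 0)"
      by (intro tendsto_lowerbound[where F = "at_right (0::real)"]) auto
    moreover have "U \<subseteq> {x}" using sub 3 by auto
    ultimately show ?thesis by (intro that[of "{x}"]) (auto simp: sets)
  qed
qed

text \<open>
  Every cover of \<open>E\<close> by sets of small diameter has \<open>s\<close>-sum at least a constant multiple of the
  mass of \<open>E\<close>, since each covering set sits in a measurable set whose mass its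
  \<open>diam_pow\<close> controls.\<close>
lemma mass_distribution_principle:
  fixes \<mu> :: "'a::metric_space measure"
  assumes sets: "sets \<mu> = sets borel" and "0 \<le> s" "0 \<le> C"
    and ball: "\<And>x t. 0 < t \<Longrightarrow> t < 1 \<Longrightarrow> emeasure \<mu> (cball x t) \<le> ennreal (C * t powr s)"
    and E: "E \<in> sets \<mu>"
    and null: "hausdorff_measure s E = 0"
  shows "emeasure \<mu> E = 0"
proof -
  have "emeasure \<mu> E \<le> \<epsilon>" if "0 < \<epsilon>" for \<epsilon> :: ennreal
  proof -
    have "hausdorff_pre s (1/2) E \<le> hausdorff_measure s E"
      unfolding hausdorff_measure_def by (rule SUP_upper) auto
    then have pre0: "hausdorff_pre s (1/2) E = 0" using null by simp
    define \<eta> where "\<eta> = \<epsilon> / ennreal (C + 1)"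
    have "0 < \<eta>" unfolding \<eta>_def using that \<open>0 \<le> C\<close>
      by (simp add: ennreal_zero_less_divide)
    with pre0 have "hausdorff_pre s (1/2) E < \<eta>" by simp
    then obtain U :: "nat \<Rightarrow> 'a set" where U: "(\<Sum>i. diam_pow s (U i)) < \<eta>" "E \<subseteq> (\<Union>i. U i)"
      "\<And>i. bounded (U i)" "\<And>i. diameter (U i) \<le> 1/2"
      unfolding hausdorff_pre_def Inf_less_iff by blast
    have "\<exists>V. V \<in> sets \<mu> \<and> U i \<subseteq> V \<and> emeasure \<mu> V \<le> ennreal C * diam_pow s (U i)" for i
    proof -
      have "diameter (U i) < 1" using U(4)[of i] by linarith
      show ?thesis
        by (rule diam_pow_dominates_mass[OF sets assms(2,3) ball U(3) \<open>diameter (U i) < 1\<close>]) auto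
    qed
    then obtain V where V: "\<And>i. V i \<in> sets \<mu>" "\<And>i. U i \<subseteq> V i"
      "\<And>i. emeasure \<mu> (V i) \<le> ennreal C * diam_pow s (U i)" by metis
    have "emeasure \<mu> E \<le> emeasure \<mu> (\<Union>i. V i)"
      using U(2) V(1,2) by (intro emeasure_mono) blast+
    also have "\<dots> \<le> (\<Sum>i. emeasure \<mu> (V i))"
      using V(1) by (intro emeasure_subadditive_countably) auto
    also have "\<dots> \<le> (\<Sum>i. ennreal C * diam_pow s (U i))"
      using V(3) by (intro suminf_le) auto
    also have "\<dots> = ennreal C * (\<Sum>i. diam_pow s (U i))" by simp
    also have "\<dots> \<le> ennreal (C + 1) * \<eta>"
      using U(1) \<open>0 \<le> C\<close> by (intro mult_mono) (auto intro: ennreal_leI)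
    also have "\<dots> = \<epsilon>" unfolding \<eta>_def using \<open>0 \<le> C\<close>
      by (simp add: ennreal_times_divide ennreal_mult_divide_eq mult.commute)
    finally show ?thesis .
  qed
  then have "emeasure \<mu> E \<le> 0" by (rule dense_ge)
  then show ?thesis by simp
qed

section \<open>Products with eventually small factors\<close>

lemma prod_bounded_of_eventually_le_one:
  fixes f :: "nat \<Rightarrow> real"
  assumes pos: "\<And>n. 0 < f n" and ev: "eventually (\<lambda>n. f n \<le> 1) sequentially"
  obtains C where "0 < C" "\<And>n. (\<Prod>j<n. f j) \<le> C"
proof -
  obtain N where N: "\<And>n. n \<ge> N \<Longrightarrow> f n \<le> 1" using ev by (auto simp: eventually_sequentially)
  define C where "C = (\<Prod>j<N. max 1 (f j))"
  have "(\<Prod>j<n. f j) \<le> C" for n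
  proof -
    have "(\<Prod>j<n. f j) \<le> (\<Prod>j<n. max 1 (f j))"
      by (intro prod_mono) (auto intro: less_imp_le[OF pos])
    also have "\<dots> \<le> (\<Prod>j<max n N. max 1 (f j))"
      by (intro prod_mono2) (auto simp: less_imp_le)
    also have "\<dots> = C" unfolding C_def
      by (intro prod.mono_neutral_right) (use N in \<open>auto simp: max.absorb1\<close>)
    finally show ?thesis .
  qed
  moreover have "0 < C" unfolding C_def by (intro prod_pos) (auto simp: less_max_iff_disj)
  ultimately show ?thesis using that by blast
qed

lemma prod_tendsto_zero_of_eventually_le_half:
  fixes f :: "nat \<Rightarrow> real"
  assumes pos: "\<And>n. 0 < f n" and ev: "eventually (\<lambda>n. f n \<le> 1/2) sequentially"
  shows "(\<lambda>n. \<Prod>j<n. f j) \<longlonglongrightarrow> 0"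
proof -
  have "eventually (\<lambda>n. 2 * f n \<le> 1) sequentially" using ev by eventually_elim simp
  then obtain C where C: "\<And>n. (\<Prod>j<n. 2 * f j) \<le> C"
    using prod_bounded_of_eventually_le_one[of "\<lambda>n. 2 * f n"] pos
    by (metis mult_pos_pos zero_less_numeral)
  show ?thesis
  proof (rule tendsto_sandwich)
    show "\<forall>\<^sub>F n in sequentially. (\<Prod>j<n. f j) \<le> C * (1/2)^n"
      using C by (intro always_eventually allI) (simp add: prod.distrib field_simps)
    show "\<forall>\<^sub>F n in sequentially. 0 \<le> (\<Prod>j<n. f j)"
      by (intro always_eventually allI prod_nonneg) (auto intro: less_imp_le[OF pos])
    show "(\<lambda>n. C * (1/2)^n) \<longlonglongrightarrow> 0"
      by (intro tendsto_mult_right_zero LIMSEQ_realpow_zero) auto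
  qed simp
qed

section \<open>The random digit series and its law\<close>

lemma card_nat_interval_le:
  fixes a L :: real
  assumes "0 \<le> L"
  shows "real (card {j. j < m \<and> a \<le> real j \<and> real j \<le> a + L}) \<le> L + 1"
proof -
  let ?J = "{j. j < m \<and> a \<le> real j \<and> real j \<le> a + L}"
  have "card ?J = card (int ` ?J)" by (simp add: card_image inj_on_def)
  also have "\<dots> \<le> card {\<lceil>a\<rceil>..\<lfloor>a + L\<rfloor>}"
    by (intro card_mono) (auto simp: ceiling_le_iff le_floor_iff)
  also have "\<dots> = nat (\<lfloor>a + L\<rfloor> - \<lceil>a\<rceil> + 1)" by simp
  finally have "real (card ?J) \<le> real (nat (\<lfloor>a + L\<rfloor> - \<lceil>a\<rceil> + 1))" by simp
  also have "\<dots> \<le> L + 1"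
    using assms of_int_floor_le[of "a + L"] le_of_int_ceiling[of a]
    by (cases "0 \<le> \<lfloor>a + L\<rfloor> - \<lceil>a\<rceil> + 1") linarith+
  finally show ?thesis .
qed

lemma fourier_eq_char: "fourier \<mu> \<xi> = char \<mu> (- 2 * pi * \<xi>)"
  unfolding fourier_def char_def by (intro Bochner_Integration.integral_cong) (auto simp: algebra_simps)

text \<open>
  Each exponential in \<open>H m \<xi>\<close> is within its phase of 1; this makes the Riesz product
  absolutely convergent.\<close>
lemma norm_H_minus_one_le:
  assumes "0 < m"
  shows "norm (H m \<xi> - 1) \<le> 2 * pi * real m * \<bar>\<xi>\<bar>"
proof -
  have bound: "norm (exp (- (2 * of_real pi * \<i> * of_nat j * of_real \<xi>)) - 1) \<le> 2 * pi * real m * \<bar>\<xi>\<bar>"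
    if "j < m" for j
  proof -
    have "norm (exp (- (2 * of_real pi * \<i> * of_nat j * of_real \<xi>)) - 1)
        = norm (exp (\<i> * complex_of_real (- 2 * pi * real j * \<xi>)) - 1)"
      by (simp add: algebra_simps)
    also have "\<dots> \<le> \<bar>- 2 * pi * real j * \<xi>\<bar>"
      using iexp_approx1[of "- 2 * pi * real j * \<xi>" 0] by simp
    also have "\<dots> = 2 * pi * real j * \<bar>\<xi>\<bar>" by (simp add: abs_mult)
    also have "\<dots> \<le> 2 * pi * real m * \<bar>\<xi>\<bar>"
      using that by (intro mult_right_mono mult_left_mono) auto
    finally show ?thesis .
  qed
  have "H m \<xi> - 1 = (\<Sum>j<m. exp (- (2 * of_real pi * \<i> * of_nat j * of_real \<xi>)) - 1) / of_nat m"
    using assms by (simp add: H_def sum_subtractf field_simps)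
  also have "norm \<dots> \<le> (\<Sum>j<m. 2 * pi * real m * \<bar>\<xi>\<bar>) / real m"
    unfolding norm_divide norm_of_nat
    by (intro divide_right_mono order_trans[OF norm_sum] sum_mono bound) auto
  also have "\<dots> = 2 * pi * real m * \<bar>\<xi>\<bar>" using assms by simp
  finally show ?thesis .
qed

locale digit_system =
  fixes b d :: "nat \<Rightarrow> nat"
  assumes radix: "\<And>n. n \<ge> 1 \<Longrightarrow> 1 < d n \<and> d n < b n"
begin

text \<open>
  The sequences \<open>b\<close> and \<open>d\<close> start at index 1, whereas the sequences built from them start at 0,
  so that generation \<open>n\<close> uses the first \<open>n\<close> digits. Hence the argument \<open>Suc n\<close> of \<open>rho\<close>:
  \<open>scale n\<close> is the product of the first \<open>n\<close> radices.\<close>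
definition scale :: "nat \<Rightarrow> real" where
  "scale n = real (rho b (Suc n))"

definition words :: "nat \<Rightarrow> real" where
  "words n = (\<Prod>j<n. real (d (Suc j)))"

definition weight :: "nat \<Rightarrow> real" where
  "weight n = 1 / (real (d (Suc n)) * scale n)"

text \<open>
  The factor measures live on the digit sets themselves rather than on all natural numbers:
  then every point of the product space obeys the digit bounds, and no null sets have to be
  discarded.\<close>
definition digits :: "(nat \<Rightarrow> nat) measure" where
  "digits = PiM UNIV (\<lambda>n. uniform_count_measure {..<d (Suc n)})"

definition summand :: "nat \<Rightarrow> (nat \<Rightarrow> nat) \<Rightarrow> real" where
  "summand n \<omega> = real (\<omega> n) * weight n"

definition partial_sum :: "nat \<Rightarrow> (nat \<Rightarrow> nat) \<Rightarrow> real" where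
  "partial_sum n \<omega> = (\<Sum>k<n. summand k \<omega>)"

definition total :: "(nat \<Rightarrow> nat) \<Rightarrow> real" where
  "total \<omega> = (\<Sum>k. summand k \<omega>)"

definition law :: "real measure" where
  "law = distr digits borel total"

lemma d_gt_1: "1 < d (Suc n)" and d_less_b: "d (Suc n) < b (Suc n)"
  using radix[of "Suc n"] by auto

lemma d_pos: "0 < real (d (Suc n))"
  using d_gt_1[of n] by simp

lemma b_gt_2: "2 < b (Suc n)"
  using d_gt_1[of n] d_less_b[of n] by linarith

lemma scale_0 [simp]: "scale 0 = 1"
  by (simp add: scale_def rho_def)

lemma scale_Suc: "scale (Suc n) = real (b (Suc n)) * scale n"
  by (simp add: scale_def rho_def mult.commute)

lemma scale_eq_prod: "scale n = (\<Prod>j<n. real (b (Suc j)))"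
  by (induction n) (simp_all add: scale_Suc mult.commute)

lemma scale_pos: "0 < scale n"
  unfolding scale_eq_prod using b_gt_2 by (intro prod_pos) (auto intro: less_trans[of 0 2])

lemma scale_double: "2 * scale n \<le> scale (Suc n)"
  using b_gt_2[of n] scale_pos[of n] by (simp add: scale_Suc)

lemma scale_ge_power: "2 ^ n \<le> scale n"
proof (induction n)
  case (Suc n)
  then show ?case using scale_double[of n] by simp
qed simp

lemma inverse_scale_tendsto_0: "(\<lambda>n. 1 / scale n) \<longlonglongrightarrow> 0"
proof (rule tendsto_sandwich[OF _ _ tendsto_const])
  show "\<forall>\<^sub>F n in sequentially. 1 / scale n \<le> (1/2) ^ n"
    using scale_ge_power scale_pos by (intro always_eventually) (simp add: power_divide frac_le)
  show "(\<lambda>n. (1/2) ^ n) \<longlonglongrightarrow> (0::real)" by (rule LIMSEQ_realpow_zero) auto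
  show "\<forall>\<^sub>F n in sequentially. 0 \<le> 1 / scale n"
    using scale_pos by (intro always_eventually) (auto intro: less_imp_le)
qed

lemma words_pos: "0 < words n"
  unfolding words_def by (intro prod_pos) (simp only: d_pos ball_simps simp_thms)

lemma words_Suc: "words (Suc n) = real (d (Suc n)) * words n"
  by (simp add: words_def)

lemma words_0 [simp]: "words 0 = 1"
  by (simp add: words_def)

lemma weight_pos: "0 < weight n"
  unfolding weight_def using scale_pos d_pos by simp

interpretation D: product_prob_space "\<lambda>n. uniform_count_measure {..<d (Suc n)}" UNIV
proof (intro product_prob_spaceI prob_space_uniform_count_measure)
  show "{..<d (Suc n)} \<noteq> {}" for n using d_gt_1[of n] by (auto simp: lessThan_empty_iff)
qed simp

lemma prob_space_digits: "prob_space digits"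
  unfolding digits_def by (rule D.prob_space_axioms)

interpretation P: prob_space digits
  by (rule prob_space_digits)

lemma space_digits: "\<omega> \<in> space digits \<longleftrightarrow> (\<forall>n. \<omega> n < d (Suc n))"
  by (auto simp: digits_def space_PiM space_uniform_count_measure PiE_iff)

lemma measurable_digit: "(\<lambda>\<omega>. \<omega> n) \<in> digits \<rightarrow>\<^sub>M uniform_count_measure {..<d (Suc n)}"
  unfolding digits_def by (rule measurable_component_singleton) simp

lemma measurable_uniform_count: "f \<in> uniform_count_measure A \<rightarrow>\<^sub>M N" if "f \<in> A \<rightarrow> space N"
  using that by (auto simp: measurable_def space_uniform_count_measure sets_uniform_count_measure)

lemma measurable_summand [measurable]: "summand n \<in> borel_measurable digits"
  unfolding summand_def
  by (rule measurable_compose[OF measurable_digit measurable_uniform_count]) auto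

lemma measurable_partial_sum [measurable]: "partial_sum n \<in> borel_measurable digits"
  unfolding partial_sum_def by measurable

lemma measurable_total [measurable]: "total \<in> borel_measurable digits"
  unfolding total_def by measurable

lemma summand_bounds:
  assumes "\<omega> \<in> space digits"
  shows "0 \<le> summand n \<omega>" "summand n \<omega> \<le> 1 / scale n"
proof -
  show "0 \<le> summand n \<omega>"
    using weight_pos[of n] by (simp add: summand_def)
  have "real (\<omega> n) \<le> real (d (Suc n))"
    using assms by (simp add: space_digits less_imp_le)
  then have "summand n \<omega> \<le> real (d (Suc n)) * weight n"
    unfolding summand_def using weight_pos[of n] by (intro mult_right_mono) auto
  also have "\<dots> = 1 / scale n" using d_pos[of n] by (simp add: weight_def)
  finally show "summand n \<omega> \<le> 1 / scale n" .
qed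

lemma partial_sum_Suc: "partial_sum (Suc n) \<omega> = partial_sum n \<omega> + summand n \<omega>"
  by (simp add: partial_sum_def)

lemma partial_sum_mono:
  assumes "\<omega> \<in> space digits" "n \<le> m"
  shows "partial_sum n \<omega> \<le> partial_sum m \<omega>"
  unfolding partial_sum_def using assms summand_bounds(1) by (intro sum_mono2) auto

text \<open>
  The tail bound in telescoping form: a summand is at most \<open>1 / scale m\<close>, which is at most
  \<open>2 / scale m - 2 / scale (m + 1)\<close> because the scales at least double.\<close>
lemma tail_telescope:
  assumes "\<omega> \<in> space digits" "n \<le> m"
  shows "partial_sum m \<omega> + 2 / scale m \<le> partial_sum n \<omega> + 2 / scale n"
  using assms(2)
proof (induction m rule: dec_induct)
  case (step m)
  have "2 / scale (Suc m) \<le> 2 / (2 * scale m)"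
    using scale_double[of m] scale_pos[of m] by (intro divide_left_mono) (auto simp: scale_pos)
  then have "summand m \<omega> + 2 / scale (Suc m) \<le> 2 / scale m"
    using summand_bounds(2)[OF assms(1), of m] by (simp add: field_simps)
  then show ?case using step.IH by (simp add: partial_sum_Suc)
qed simp

lemma summand_sums_total:
  assumes "\<omega> \<in> space digits"
  shows "(\<lambda>n. partial_sum n \<omega>) \<longlonglongrightarrow> total \<omega>"
proof -
  have "partial_sum n \<omega> \<le> 2" for n
    using tail_telescope[OF assms, of 0 n] scale_pos[of n] by (simp add: partial_sum_def[of 0])
      (smt (verit) divide_pos_pos)
  then have "summable (\<lambda>n. summand n \<omega>)"
    using summand_bounds(1)[OF assms] unfolding partial_sum_def
    by (intro bounded_imp_summable[where B = 2]) (simp_all only: flip: lessThan_Suc_atMost)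
  then show ?thesis
    unfolding total_def partial_sum_def by (simp add: summable_LIMSEQ)
qed

lemma total_bounds:
  assumes "\<omega> \<in> space digits"
  shows "partial_sum n \<omega> \<le> total \<omega>" "total \<omega> \<le> partial_sum n \<omega> + 2 / scale n"
proof -
  show "partial_sum n \<omega> \<le> total \<omega>"
    using partial_sum_mono[OF assms] by (intro LIMSEQ_le_const[OF summand_sums_total[OF assms]]) auto
  have "partial_sum m \<omega> \<le> partial_sum n \<omega> + 2 / scale n" if "n \<le> m" for m
    using tail_telescope[OF assms that] scale_pos[of m] by (smt (verit) divide_pos_pos)
  then show "total \<omega> \<le> partial_sum n \<omega> + 2 / scale n"
    by (intro LIMSEQ_le_const2[OF summand_sums_total[OF assms]]) auto
qed

lemma total_range: "\<omega> \<in> space digits \<Longrightarrow> total \<omega> \<in> {0..2}"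
  using total_bounds[of \<omega> 0] by (simp add: partial_sum_def)

lemma indep_digits:
  "P.indep_vars (\<lambda>n. uniform_count_measure {..<d (Suc n)}) (\<lambda>n \<omega>. \<omega> n) UNIV"
proof (subst P.indep_vars_iff_distr_eq_PiM)
  show "distr digits (PiM UNIV (\<lambda>n. uniform_count_measure {..<d (Suc n)})) (\<lambda>\<omega>. \<lambda>i\<in>UNIV. \<omega> i)
    = PiM UNIV (\<lambda>n. distr digits (uniform_count_measure {..<d (Suc n)}) (\<lambda>\<omega>. \<omega> n))"
    using distr_id[of digits] by (simp add: digits_def D.PiM_component restrict_UNIV id_def)
qed (simp_all add: measurable_digit)

lemma indep_summands: "P.indep_vars (\<lambda>_. borel) summand UNIV"
  using P.indep_vars_compose2[OF indep_digits, of "\<lambda>n j. real j * weight n" "\<lambda>_. borel"]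
  by (simp add: summand_def[abs_def] measurable_uniform_count)

lemma law_real_distribution: "real_distribution law"
  unfolding law_def by (rule P.real_distribution_distr) simp

lemma char_summand:
  "char (distr digits borel (summand n)) (- 2 * pi * \<xi>) = H (d (Suc n)) (\<xi> / (real (d (Suc n)) * scale n))"
proof -
  let ?U = "uniform_count_measure {..<d (Suc n)}"
  let ?g = "\<lambda>j. exp (\<i> * complex_of_real (- 2 * pi * \<xi> * (real j * weight n)))"
  have "char (distr digits borel (summand n)) (- 2 * pi * \<xi>)
      = (\<integral>\<omega>. ?g (\<omega> n) \<partial>digits)"
    unfolding char_def by (subst integral_distr) (simp_all add: summand_def)
  also have "\<dots> = (\<integral>j. ?g j \<partial>distr digits ?U (\<lambda>\<omega>. \<omega> n))"
    by (subst integral_distr[OF measurable_digit]) (auto intro!: measurable_uniform_count)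
  also have "distr digits ?U (\<lambda>\<omega>. \<omega> n) = ?U"
    unfolding digits_def by (simp add: D.PiM_component)
  also have "(\<integral>j. ?g j \<partial>?U) = (\<Sum>j<d (Suc n). ?g j) / of_nat (d (Suc n))"
    by (simp add: uniform_count_measure_def lebesgue_integral_point_measure_finite
        scaleR_conv_of_real sum_divide_distrib field_simps)
  also have "\<dots> = H (d (Suc n)) (\<xi> / (real (d (Suc n)) * scale n))"
    by (simp add: H_def weight_def algebra_simps)
  finally show ?thesis .
qed

lemma char_partial_sum:
  "char (distr digits borel (partial_sum n)) (- 2 * pi * \<xi>)
     = (\<Prod>k<n. H (d (Suc k)) (\<xi> / (real (d (Suc k)) * scale k)))"
  unfolding partial_sum_def
  by (subst P.char_distr_sum[OF P.indep_vars_subset[OF indep_summands]]) (simp_all only: char_summand subset_UNIV)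

lemma char_partial_sum_tendsto:
  "(\<lambda>n. char (distr digits borel (partial_sum n)) t) \<longlonglongrightarrow> char law t"
proof -
  have "(\<lambda>n. \<integral>\<omega>. iexp (t * partial_sum n \<omega>) \<partial>digits) \<longlonglongrightarrow> (\<integral>\<omega>. iexp (t * total \<omega>) \<partial>digits)"
  proof (rule integral_dominated_convergence[where w = "\<lambda>_. 1"])
    show "AE \<omega> in digits. (\<lambda>n. iexp (t * partial_sum n \<omega>)) \<longlonglongrightarrow> iexp (t * total \<omega>)"
      by (intro AE_I2 tendsto_intros summand_sums_total)
  qed simp_all
  then show ?thesis by (simp add: char_def law_def integral_distr)
qed

text \<open>
  Convergence in the sense of \<open>has_prod\<close> is stronger than convergence of the partial products,
  as it excludes products that tend to 0 without a vanishing factor. It follows from absolute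
  convergence, and the limit of the partial products then names the value.\<close>
lemma fourier_law_has_prod:
  "(\<lambda>n. H (d (Suc n)) (\<xi> / (real (d (Suc n)) * scale n))) has_prod fourier law \<xi>"
proof -
  let ?f = "\<lambda>n. H (d (Suc n)) (\<xi> / (real (d (Suc n)) * scale n))"
  have bound: "norm (norm (?f n - 1)) \<le> 2 * pi * \<bar>\<xi>\<bar> * (1/2) ^ n" for n
  proof -
    have "norm (?f n - 1) \<le> 2 * pi * real (d (Suc n)) * \<bar>\<xi> / (real (d (Suc n)) * scale n)\<bar>"
      using d_pos[of n] by (intro norm_H_minus_one_le) simp
    also have "\<dots> = 2 * pi * \<bar>\<xi>\<bar> * (1 / scale n)"
      using d_pos[of n] scale_pos[of n] by (simp add: abs_mult)
    also have "\<dots> \<le> 2 * pi * \<bar>\<xi>\<bar> * (1/2) ^ n"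
      using scale_ge_power[of n] by (intro mult_left_mono) (auto simp: power_divide intro!: frac_le)
    finally show ?thesis by simp
  qed
  have "summable (\<lambda>n. norm (?f n - 1))"
    by (rule summable_comparison_test'[OF summable_mult[OF summable_geometric] bound]) simp
  then have conv: "convergent_prod ?f"
    by (intro abs_convergent_prod_imp_convergent_prod summable_imp_abs_convergent_prod)
  have "(\<lambda>n. \<Prod>k<n. ?f k) \<longlonglongrightarrow> fourier law \<xi>"
    using char_partial_sum_tendsto[of "- 2 * pi * \<xi>"] by (simp only: char_partial_sum fourier_eq_char)
  then have "(\<lambda>n. \<Prod>k\<le>n. ?f k) \<longlonglongrightarrow> fourier law \<xi>"
    using LIMSEQ_Suc by (fastforce simp: lessThan_Suc_atMost)
  then have "fourier law \<xi> = prodinf ?f"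
    by (rule LIMSEQ_unique[OF _ convergent_prod_LIMSEQ[OF conv]])
  with convergent_prod_has_prod[OF conv] show ?thesis by simp
qed

text \<open>
  The law has compact support and the required Fourier transform; conversely the values of an
  infinite product are unique, so any other candidate has the same characteristic function.\<close>
lemma riesz_product_eq_law: "riesz_product b d = law"
  unfolding riesz_product_def
proof (rule the_equality)
  interpret L: real_distribution law by (rule law_real_distribution)
  have "emeasure law {0..2} = 1"
    unfolding law_def
    using total_range by (subst emeasure_distr) (auto intro!: P.emeasure_eq_1_AE)
  then have "\<exists>K. compact K \<and> emeasure law K = 1"
    by (intro exI[of _ "{0..2}"]) simp
  then show "is_riesz_product b d law"
    unfolding is_riesz_product_def
    using fourier_law_has_prod L.prob_space_axioms by (simp add: scale_def)
next
  fix \<nu> assume \<nu>: "is_riesz_product b d \<nu>"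
  then have "real_distribution \<nu>"
    by (simp add: is_riesz_product_def real_distribution_def real_distribution_axioms_def)
  moreover have "char \<nu> t = char law t" for t
  proof -
    have "fourier \<nu> (- t / (2 * pi)) = fourier law (- t / (2 * pi))"
      using \<nu> fourier_law_has_prod[of "- t / (2 * pi)"]
      unfolding is_riesz_product_def scale_def by (meson has_prod_unique2)
    then show ?thesis by (simp add: fourier_eq_char)
  qed
  ultimately show "\<nu> = law"
    by (intro Levy_uniqueness law_real_distribution) auto
qed

section \<open>Concentration of the partial sums\<close>

abbreviation partial_law :: "nat \<Rightarrow> real measure" where
  "partial_law n \<equiv> distr digits borel (partial_sum n)"

lemma prob_space_partial_law: "prob_space (partial_law n)"
  by (rule P.prob_space_distr) simp

lemma prob_digit:
  assumes "j < d (Suc n)"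
  shows "P.prob (summand n -` {real j * weight n} \<inter> space digits) = 1 / real (d (Suc n))"
proof -
  let ?U = "uniform_count_measure {..<d (Suc n)}"
  have "summand n -` {real j * weight n} \<inter> space digits = (\<lambda>\<omega>. \<omega> n) -` {j} \<inter> space digits"
    using weight_pos[of n] by (auto simp: summand_def)
  also have "P.prob \<dots> = measure (distr digits ?U (\<lambda>\<omega>. \<omega> n)) {j}"
    using assms by (subst measure_distr[OF measurable_digit]) (auto simp: sets_uniform_count_measure)
  also have "distr digits ?U (\<lambda>\<omega>. \<omega> n) = ?U"
    unfolding digits_def by (simp add: D.PiM_component)
  finally show ?thesis
    using assms by (simp add: measure_uniform_count_measure)
qed

lemma indep_summand_partial_sum: "P.indep_var borel (summand n) borel (partial_sum n)"
  unfolding partial_sum_def[abs_def]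
  by (rule P.indep_vars_sum) (auto intro: P.indep_vars_subset[OF indep_summands])

text \<open>
  If \<open>partial_sum (Suc n)\<close> falls into a window of length \<open>l\<close>, then \<open>partial_sum n\<close> falls into
  the window enlarged to the left by \<open>1 / scale n\<close>, which bounds the summand. Given
  \<open>partial_sum n\<close>, at most \<open>l / weight n + 1\<close> of the \<open>d (Suc n)\<close> equally likely digits lead into the
  window, because the summands are spaced by \<open>weight n\<close>.\<close>
lemma partial_law_step:
  assumes "0 \<le> l"
  shows "measure (partial_law (Suc n)) {x..x + l}
    \<le> (l * scale n + 1 / real (d (Suc n))) * measure (partial_law n) {x - 1 / scale n..x + l}"
proof -
  interpret L: prob_space "partial_law n" by (rule prob_space_partial_law)
  define m where "m = d (Suc n)"
  define w where "w = weight n"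
  define I where "I j = {x - real j * w..x - real j * w + l}" for j :: nat
  have w: "0 < w" unfolding w_def by (rule weight_pos)
  have m: "0 < real m" unfolding m_def by (rule d_pos)
  have mw: "real m * w = 1 / scale n" using d_pos[of n] by (simp add: m_def w_def weight_def)
  let ?A = "\<lambda>j. (\<lambda>\<omega>. (summand n \<omega>, partial_sum n \<omega>)) -` ({real j * w} \<times> I j) \<inter> space digits"
  have A: "?A j \<in> sets digits" for j
  proof -
    have "(\<lambda>\<omega>. (summand n \<omega>, partial_sum n \<omega>)) \<in> digits \<rightarrow>\<^sub>M borel \<Otimes>\<^sub>M borel" by measurable
    then show ?thesis by (rule measurable_sets) (auto simp: I_def)
  qed
  have "measure (partial_law (Suc n)) {x..x + l} = P.prob (partial_sum (Suc n) -` {x..x + l} \<inter> space digits)"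
    by (rule measure_distr) auto
  also have "\<dots> \<le> P.prob (\<Union>j<m. ?A j)"
  proof (rule P.finite_measure_mono)
    show "partial_sum (Suc n) -` {x..x + l} \<inter> space digits \<subseteq> (\<Union>j<m. ?A j)"
    proof
      fix \<omega> assume "\<omega> \<in> partial_sum (Suc n) -` {x..x + l} \<inter> space digits"
      then have "\<omega> n < m" "\<omega> \<in> ?A (\<omega> n)"
        by (auto simp: space_digits m_def I_def w_def partial_sum_Suc summand_def)
      then show "\<omega> \<in> (\<Union>j<m. ?A j)" by blast
    qed
  qed (use A in blast)
  also have "\<dots> \<le> (\<Sum>j<m. P.prob (?A j))"
    by (rule P.finite_measure_subadditive_finite) (use A in auto)
  also have "\<dots> = (\<Sum>j<m. 1 / real m * measure (partial_law n) (I j))"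
  proof (rule sum.cong[OF refl])
    fix j assume "j \<in> {..<m}"
    then show "P.prob (?A j) = 1 / real m * measure (partial_law n) (I j)"
      by (subst P.indep_varD[OF indep_summand_partial_sum])
        (auto simp: I_def w_def m_def prob_digit measure_distr)
  qed
  \<comment> \<open>Written as an integral, the sum over the digits can be estimated pointwise.\<close>
  also have "\<dots> = 1 / real m * (\<integral>y. (\<Sum>j<m. indicator (I j) y) \<partial>partial_law n)"
    by (subst Bochner_Integration.integral_sum)
      (auto simp: sum_distrib_left I_def intro!: integrable_real_indicator simp: L.emeasure_eq_measure)
  also have "\<dots> \<le> 1 / real m * (\<integral>y. (l / w + 1) * indicator {x - 1 / scale n..x + l} y \<partial>partial_law n)"
  proof (intro mult_left_mono integral_mono)
    fix y
    have card: "(\<Sum>j<m. indicator (I j) y) = real (card {j. j < m \<and> y \<in> I j})"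
      by (simp add: indicator_def of_bool_def sum.If_cases Int_def)
    show "(\<Sum>j<m. indicator (I j) y) \<le> (l / w + 1) * indicator {x - 1 / scale n..x + l} y"
    proof (cases "y \<in> {x - 1 / scale n..x + l}")
      case True
      have "{j. j < m \<and> y \<in> I j} = {j. j < m \<and> (x - y) / w \<le> real j \<and> real j \<le> (x - y) / w + l / w}"
        using w by (auto simp: I_def field_simps)
      then have "real (card {j. j < m \<and> y \<in> I j}) \<le> l / w + 1"
        using card_nat_interval_le[of "l / w" m "(x - y) / w"] assms w by simp
      then show ?thesis using True card by simp
    next
      case False
      have "y \<notin> I j" if "j < m" for j
      proof
        assume "y \<in> I j"
        moreover have "real j * w \<le> real m * w" "0 \<le> real j * w"
          using that w by (auto intro: mult_right_mono)
        ultimately show False using False mw by (auto simp: I_def)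
      qed
      then have "{j. j < m \<and> y \<in> I j} = {}" by blast
      then show ?thesis using False card by simp
    qed
  next
    show "integrable (partial_law n) (\<lambda>y. \<Sum>j<m. indicator (I j) y :: real)"
      by (auto simp: I_def intro!: integrable_real_indicator simp: L.emeasure_eq_measure)
  next
    show "integrable (partial_law n) (\<lambda>y. (l / w + 1) * indicator {x - 1 / scale n..x + l} y)"
      by (auto intro!: integrable_real_indicator simp: L.emeasure_eq_measure)
  qed (use m in auto)
  also have "\<dots> = (1 / real m * (l / w + 1)) * measure (partial_law n) {x - 1 / scale n..x + l}"
    by simp
  also have "1 / real m * (l / w + 1) = l * scale n + 1 / real m"
    using m w mw scale_pos[of n] by (simp add: field_simps)
  finally show ?thesis by (simp add: m_def)
qed

text \<open>
  The window length \<open>c / scale n\<close> must survive the induction step, i.e.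
  \<open>c / scale (n + 1) + 1 / scale n \<le> c / scale n\<close>, which holds for every \<open>c \<ge> 2\<close>; each step then
  costs a factor \<open>(c + 1) / d (n + 1)\<close>. The value \<open>c = 5\<close> is what the next lemma asks for.\<close>
lemma partial_law_concentration:
  "measure (partial_law n) {x..x + 5 / scale n} \<le> 6 ^ n / words n"
proof (induction n arbitrary: x)
  case 0
  show ?case using prob_space.prob_le_1[OF prob_space_partial_law[of 0]] by simp
next
  case (Suc n)
  interpret L: prob_space "partial_law n" by (rule prob_space_partial_law)
  let ?l = "5 / scale (Suc n)"
  have "?l \<le> 5 / (2 * scale n)"
    using scale_double[of n] scale_pos[of n] by (intro divide_left_mono) (auto simp: scale_pos)
  also have "\<dots> + 1 / scale n \<le> 5 / scale n"
    using scale_pos[of n] by (simp add: field_simps)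
  finally have len: "?l + 1 / scale n \<le> 5 / scale n" by simp
  have "?l * scale n = 5 / real (b (Suc n))"
    using scale_pos[of n] by (simp add: scale_Suc)
  also have "\<dots> \<le> 5 / real (d (Suc n))"
    using d_less_b[of n] d_pos[of n] b_gt_2[of n] by (intro divide_left_mono) auto
  finally have factor: "?l * scale n + 1 / real (d (Suc n)) \<le> 6 / real (d (Suc n))" by simp
  have "measure (partial_law (Suc n)) {x..x + ?l}
    \<le> (?l * scale n + 1 / real (d (Suc n))) * measure (partial_law n) {x - 1 / scale n..x + ?l}"
    using scale_pos[of "Suc n"] by (intro partial_law_step) simp
  also have "\<dots> \<le> 6 / real (d (Suc n)) * (6 ^ n / words n)"
  proof (rule mult_mono[OF factor])
    have "measure (partial_law n) {x - 1 / scale n..x + ?l}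
        \<le> measure (partial_law n) {(x - 1 / scale n)..(x - 1 / scale n) + 5 / scale n}"
      using len by (intro L.finite_measure_mono) auto
    also have "\<dots> \<le> 6 ^ n / words n" by (rule Suc.IH)
    finally show "measure (partial_law n) {x - 1 / scale n..x + ?l} \<le> 6 ^ n / words n" .
  qed (use d_pos[of n] in auto)
  finally show ?case by (simp add: words_Suc)
qed

text \<open>
  For radii between two scales, \<open>4 * t * scale n\<close> is, up to a constant, the proportion of a
  cylinder of generation \<open>n\<close> that the ball can see, and \<open>1 / d (n + 1)\<close> covers the case that the
  ball is shorter than the gap between neighbouring cylinders of generation \<open>n + 1\<close> but still
  meets one. A ball of radius \<open>t\<close> for the full series becomes a window of length \<open>4 * t\<close> for the partial sum, since the tail is at most
  \<open>2 * t\<close>; one step back its length is at most \<open>5 / scale n\<close>.\<close>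
lemma law_ball_bound:
  assumes t: "1 / scale (Suc n) \<le> t" "t < 1 / scale n"
  shows "measure law (cball x t) \<le> (4 * t * scale n + 1 / real (d (Suc n))) * (6 ^ n / words n)"
proof -
  interpret L: prob_space "partial_law n" by (rule prob_space_partial_law)
  have t0: "0 < t" using t(1) scale_pos[of "Suc n"] by (smt (verit) divide_pos_pos)
  let ?y = "x - 3 * t"
  have "measure law (cball x t) = P.prob (total -` {x - t..x + t} \<inter> space digits)"
    unfolding law_def by (subst measure_distr) (auto simp: cball_eq_atLeastAtMost)
  also have "\<dots> \<le> P.prob (partial_sum (Suc n) -` {?y..?y + 4 * t} \<inter> space digits)"
  proof (rule P.finite_measure_mono)
    show "total -` {x - t..x + t} \<inter> space digits \<subseteq> partial_sum (Suc n) -` {?y..?y + 4 * t} \<inter> space digits"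
      using total_bounds[of _ "Suc n"] t(1) by fastforce
  qed (auto intro: measurable_sets)
  also have "\<dots> = measure (partial_law (Suc n)) {?y..?y + 4 * t}"
    by (subst measure_distr) auto
  also have "\<dots> \<le> (4 * t * scale n + 1 / real (d (Suc n))) * measure (partial_law n) {?y - 1 / scale n..?y + 4 * t}"
    using t0 by (intro partial_law_step) simp
  also have "\<dots> \<le> (4 * t * scale n + 1 / real (d (Suc n))) * (6 ^ n / words n)"
  proof (rule mult_left_mono)
    have "measure (partial_law n) {?y - 1 / scale n..?y + 4 * t}
      \<le> measure (partial_law n) {(?y - 1 / scale n)..(?y - 1 / scale n) + 5 / scale n}"
      using t(2) by (intro L.finite_measure_mono) auto
    also have "\<dots> \<le> 6 ^ n / words n" by (rule partial_law_concentration)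
    finally show "measure (partial_law n) {?y - 1 / scale n..?y + 4 * t} \<le> 6 ^ n / words n" .
  qed (use t0 scale_pos[of n] in auto)
  finally show ?thesis .
qed

lemma scale_bracket:
  assumes "0 < t" "t < 1"
  obtains n where "1 / scale (Suc n) \<le> t" "t < 1 / scale n"
proof -
  define m where "m = (LEAST m. 1 / scale m \<le> t)"
  have "eventually (\<lambda>m. 1 / scale m < t) sequentially"
    using inverse_scale_tendsto_0 assms(1) by (rule order_tendstoD)
  then obtain k where "1 / scale k < t" by (auto simp: eventually_sequentially)
  then have m: "1 / scale m \<le> t" 
    unfolding m_def using LeastI[of "\<lambda>m. 1 / scale m \<le> t" k] by simp
  moreover have "m \<noteq> 0" using m assms(2) by (cases m) auto
  then obtain n where n: "m = Suc n" by (cases m) auto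
  moreover have "\<not> 1 / scale n \<le> t"
    using not_less_Least[of n "\<lambda>m. 1 / scale m \<le> t"] n unfolding m_def by simp
  ultimately show ?thesis using that by auto
qed

text \<open>
  The two terms of the ball estimate are matched against the hypothesis at both ends of the
  range of \<open>t\<close>: the first one at generation \<open>n\<close>, where \<open>t * scale n \<le> 1\<close> and \<open>s \<le> 1\<close> give
  \<open>t * scale n \<le> (t * scale n) powr s\<close>, the second one at generation \<open>n + 1\<close>, where
  \<open>1 / scale (n + 1) \<le> t\<close>.\<close>
lemma law_Frostman:
  assumes s: "0 \<le> s" "s \<le> 1"
    and C: "\<And>n. 6 ^ n * scale n powr s \<le> C * words n"
    and t: "0 < t" "t < 1"
  shows "measure law (cball x t) \<le> 5 * C * t powr s"
proof -
  obtain n where n: "1 / scale (Suc n) \<le> t" "t < 1 / scale n"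
    using scale_bracket[OF t] .
  have C0: "0 < C" using C[of 0] by simp
  have ts: "0 < t * scale n" "t * scale n \<le> 1"
    using t n(2) scale_pos[of n] by (auto simp: field_simps)
  have "t * scale n \<le> (t * scale n) powr s"
    using powr_mono'[of s 1 "t * scale n"] ts s by simp
  then have "t * scale n * (6 ^ n / words n) \<le> (t * scale n) powr s * (6 ^ n / words n)"
    using words_pos[of n] by (intro mult_right_mono) auto
  also have "\<dots> = t powr s * (6 ^ n * scale n powr s / words n)"
    using t scale_pos[of n] by (simp add: powr_mult)
  also have "\<dots> \<le> t powr s * C"
    using C[of n] words_pos[of n] by (intro mult_left_mono) (auto simp: field_simps)
  finally have coarse: "t * scale n * (6 ^ n / words n) \<le> C * t powr s" by (simp add: mult.commute)
  have "6 ^ n / words (Suc n) \<le> 6 ^ Suc n / words (Suc n)"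
    using words_pos[of "Suc n"] by (intro divide_right_mono) auto
  also have "\<dots> = (6 ^ Suc n * scale (Suc n) powr s / words (Suc n)) * (1 / scale (Suc n)) powr s"
    using scale_pos[of "Suc n"] by (simp add: powr_divide)
  also have "\<dots> \<le> C * t powr s"
    using C[of "Suc n"] words_pos[of "Suc n"] C0 n(1) s(1) scale_pos[of "Suc n"]
    by (intro mult_mono powr_mono2) (auto simp: field_simps)
  finally have fine: "6 ^ n / words (Suc n) \<le> C * t powr s" .
  have "measure law (cball x t) \<le> (4 * t * scale n + 1 / real (d (Suc n))) * (6 ^ n / words n)"
    by (rule law_ball_bound[OF n])
  also have "\<dots> = 4 * (t * scale n * (6 ^ n / words n)) + 6 ^ n / words (Suc n)"
    by (simp add: words_Suc algebra_simps)
  also have "\<dots> \<le> 5 * C * t powr s" using coarse fine by linarith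
  finally show ?thesis .
qed

section \<open>A closed set carrying the law\<close>

text \<open>
  The values of \<open>partial_sum n\<close>. Different digit words may give the same value, so the
  cardinality of this set is only bounded by the number of words.\<close>
primrec nodes :: "nat \<Rightarrow> real set" where
  "nodes 0 = {0}"
| "nodes (Suc n) = (\<lambda>(v, j). v + real j * weight n) ` (nodes n \<times> {..<d (Suc n)})"

definition support :: "real set" where
  "support = (\<Inter>n. \<Union>v\<in>nodes n. {v..v + 2 / scale n})"

lemma finite_nodes: "finite (nodes n)"
  by (induction n) auto

lemma card_nodes_le: "real (card (nodes n)) \<le> words n"
proof (induction n)
  case (Suc n)
  have "card (nodes (Suc n)) \<le> card (nodes n \<times> {..<d (Suc n)})"
    unfolding nodes.simps by (rule card_image_le) (simp add: finite_nodes)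
  then have "real (card (nodes (Suc n))) \<le> real (card (nodes n)) * real (d (Suc n))"
    by (simp only: card_cartesian_product card_lessThan of_nat_mult[symmetric] of_nat_le_iff)
  also have "\<dots> \<le> words n * real (d (Suc n))" using Suc.IH by (intro mult_right_mono) auto
  finally show ?case by (simp add: words_Suc mult.commute)
qed simp

lemma partial_sum_in_nodes: "\<omega> \<in> space digits \<Longrightarrow> partial_sum n \<omega> \<in> nodes n"
proof (induction n)
  case (Suc n)
  then show ?case
    by (auto simp: partial_sum_Suc summand_def space_digits intro!: image_eqI[of _ _ "(partial_sum n \<omega>, \<omega> n)"])
qed (simp add: partial_sum_def)

lemma support_borel: "support \<in> sets borel"
  unfolding support_def by (intro sets.countable_INT'' borel_closed closed_UN finite_nodes) auto

lemma law_support: "emeasure law support = 1"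
proof -
  have "total \<omega> \<in> support" if "\<omega> \<in> space digits" for \<omega>
    using total_bounds[OF that] partial_sum_in_nodes[OF that] unfolding support_def by fastforce
  then have "emeasure law support = emeasure digits (space digits)"
    unfolding law_def using support_borel
    by (subst emeasure_distr) (auto intro!: arg_cong[where f = "emeasure digits"])
  then show ?thesis by (simp add: P.emeasure_space_1)
qed

text \<open>
  The \<open>n\<close>-th generation is a cover by at most \<open>words n\<close> intervals of length
  \<open>2 / scale n\<close>.\<close>
lemma support_null:
  assumes "0 < s" and lim: "(\<lambda>n. words n * (2 / scale n) powr s) \<longlonglongrightarrow> 0"
  shows "hausdorff_measure s support = 0"
proof -
  have "hausdorff_pre s \<delta> support \<le> 0" if "0 < \<delta>" for \<delta>
  proof (rule tendsto_lowerbound)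
    show "(\<lambda>n. ennreal (words n * (2 / scale n) powr s)) \<longlonglongrightarrow> 0"
      using tendsto_ennrealI[OF lim] by simp
    have "(\<lambda>n. 2 * (1 / scale n)) \<longlonglongrightarrow> 0"
      by (intro tendsto_mult_right_zero inverse_scale_tendsto_0)
    then have "eventually (\<lambda>n. 2 * (1 / scale n) < \<delta>) sequentially"
      using that by (rule order_tendstoD)
    then show "eventually (\<lambda>n. hausdorff_pre s \<delta> support \<le> ennreal (words n * (2 / scale n) powr s)) sequentially"
    proof eventually_elim
      case (elim n)
      have pos: "0 < 2 / scale n" using scale_pos by simp
      have diam: "diameter {v..v + 2 / scale n} = 2 / scale n" for v
        using pos by (simp add: diameter_closed_interval)
      have "hausdorff_pre s \<delta> support \<le> (\<Sum>v\<in>nodes n. diam_pow s {v..v + 2 / scale n})"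
        using elim that
        by (intro hausdorff_pre_le_finite_cover finite_nodes) (auto simp: support_def diam)
      also have "\<dots> = ennreal (real (card (nodes n)) * (2 / scale n) powr s)"
        using pos \<open>0 < s\<close> by (simp add: diam_pow_def diam ennreal_mult ennreal_of_nat_eq_real_of_nat)
      also have "\<dots> \<le> ennreal (words n * (2 / scale n) powr s)"
        by (intro ennreal_leI mult_right_mono card_nodes_le) simp
      finally show ?case .
    qed
  qed simp
  then show ?thesis by (simp add: hausdorff_measure_def)
qed

end

section \<open>Comparison of the growth of digits and radices\<close>

text \<open>
  With a number \<open>s'\<close> strictly between \<open>s\<close> and \<open>\<alpha>\<close> one has \<open>d n > b n powr s'\<close>
  eventually, and the surplus \<open>b n powr (s' - s)\<close> eventually exceeds any constant \<open>K\<close>. The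
  next lemma is the mirror image, with \<open>s'\<close> between \<open>\<alpha>\<close> and \<open>s\<close>.\<close>
lemma eventually_ln_ratio_greater:
  fixes \<alpha> :: real
  assumes "filterlim b at_top sequentially"
    and "(\<lambda>n. ln (real (d n)) / ln (real (b n))) \<longlonglongrightarrow> \<alpha>" and "s < \<alpha>"
    and "eventually (\<lambda>n. 0 < d n) sequentially" and "0 < K"
  shows "eventually (\<lambda>n. K * real (b n) powr s \<le> real (d n)) sequentially"
proof -
  define s' where "s' = (s + \<alpha>) / 2"
  have s': "s < s'" "s' < \<alpha>" using assms(3) by (auto simp: s'_def field_simps)
  have lnb: "filterlim (\<lambda>n. ln (real (b n))) at_top sequentially"
    by (intro filterlim_compose[OF ln_at_top] filterlim_compose[OF filterlim_real_sequentially] assms(1))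
  have "eventually (\<lambda>n. s' < ln (real (d n)) / ln (real (b n))) sequentially"
    using assms(2) s'(2) by (rule order_tendstoD)
  moreover have "eventually (\<lambda>n. ln K / (s' - s) \<le> ln (real (b n))) sequentially"
    using lnb by (simp add: filterlim_at_top)
  moreover have "eventually (\<lambda>n. 1 < b n) sequentially"
    using assms(1)[unfolded filterlim_at_top, rule_format, of 2] by eventually_elim simp
  ultimately show ?thesis using assms(4)
  proof eventually_elim
    case (elim n)
    have lb: "0 < ln (real (b n))" using elim(3) by simp
    have "s' * ln (real (b n)) < ln (real (d n))" using elim(1) lb by (simp add: field_simps)
    moreover have "ln K \<le> (s' - s) * ln (real (b n))" using elim(2) s'(1) by (simp add: field_simps)
    ultimately have "ln K + s * ln (real (b n)) \<le> ln (real (d n))" by (simp add: algebra_simps)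
    then have "exp (ln K + s * ln (real (b n))) \<le> exp (ln (real (d n)))" by simp
    then show ?case using elim(3,4) \<open>0 < K\<close> by (simp add: exp_add powr_def)
  qed
qed

lemma eventually_ln_ratio_less:
  fixes \<alpha> :: real
  assumes "filterlim b at_top sequentially"
    and "(\<lambda>n. ln (real (d n)) / ln (real (b n))) \<longlonglongrightarrow> \<alpha>" and "\<alpha> < s"
    and "eventually (\<lambda>n. 0 < d n) sequentially" and "0 < K"
  shows "eventually (\<lambda>n. K * real (d n) \<le> real (b n) powr s) sequentially"
proof -
  define s' where "s' = (s + \<alpha>) / 2"
  have s': "s' < s" "\<alpha> < s'" using assms(3) by (auto simp: s'_def field_simps)
  have lnb: "filterlim (\<lambda>n. ln (real (b n))) at_top sequentially"
    by (intro filterlim_compose[OF ln_at_top] filterlim_compose[OF filterlim_real_sequentially] assms(1))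
  have "eventually (\<lambda>n. ln (real (d n)) / ln (real (b n)) < s') sequentially"
    using assms(2) s'(2) by (rule order_tendstoD)
  moreover have "eventually (\<lambda>n. ln K / (s - s') \<le> ln (real (b n))) sequentially"
    using lnb by (simp add: filterlim_at_top)
  moreover have "eventually (\<lambda>n. 1 < b n) sequentially"
    using assms(1)[unfolded filterlim_at_top, rule_format, of 2] by eventually_elim simp
  ultimately show ?thesis using assms(4)
  proof eventually_elim
    case (elim n)
    have lb: "0 < ln (real (b n))" using elim(3) by simp
    have "ln (real (d n)) < s' * ln (real (b n))" using elim(1) lb by (simp add: field_simps)
    moreover have "ln K \<le> (s - s') * ln (real (b n))" using elim(2) s'(1) by (simp add: field_simps)
    ultimately have "ln K + ln (real (d n)) \<le> s * ln (real (b n))" by (simp add: algebra_simps)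
    then have "exp (ln K + ln (real (d n))) \<le> exp (s * ln (real (b n)))" by simp
    then show ?case using elim(3,4) \<open>0 < K\<close> by (simp add: exp_add powr_def)
  qed
qed

section \<open>The dimension of the Riesz product\<close>

theorem proposition1p2:
  fixes \<alpha> :: real and b d :: "nat \<Rightarrow> nat"
  assumes "0 \<le> \<alpha>" and "\<alpha> \<le> 1"
    and "\<And>n. n \<ge> 1 \<Longrightarrow> 1 < d n \<and> d n < b n"
    and "filterlim d at_top sequentially"
    and "(\<lambda>n. ln (real (d n)) / ln (real (b n))) \<longlonglongrightarrow> \<alpha>"
  shows "dim_H_measure (riesz_product b d) = ereal \<alpha>"
proof -
  interpret S: digit_system b d
    by (rule digit_system.intro) (rule assms(3))
  interpret L: real_distribution S.law by (rule S.law_real_distribution)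
  have b_lim: "filterlim b at_top sequentially"
  proof (rule filterlim_at_top_mono[OF assms(4)])
    show "eventually (\<lambda>n. d n \<le> b n) sequentially"
      using eventually_ge_at_top[of 1] by eventually_elim (simp add: assms(3) less_imp_le)
  qed
  have d_pos: "eventually (\<lambda>n. 0 < d n) sequentially"
    using assms(4)[unfolded filterlim_at_top, rule_format, of 1] by eventually_elim simp
  have b0: "0 < real (b (Suc n))" for n using S.b_gt_2[of n] by simp
  have upper: "dim_H S.support \<le> ereal s" if "\<alpha> < s" for s
  proof -
    have s: "0 < s" using that assms(1) by simp
    let ?f = "\<lambda>j. real (d (Suc j)) / real (b (Suc j)) powr s"
    have f_pos: "0 < ?f n" for n using S.d_pos[of n] b0[of n] by simp
    have "eventually (\<lambda>n. 2 * real (d (Suc n)) \<le> real (b (Suc n)) powr s) sequentially"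
      using eventually_compose_filterlim[OF
          eventually_ln_ratio_less[OF b_lim assms(5) that d_pos, of 2] filterlim_Suc]
      by simp
    then have "eventually (\<lambda>n. ?f n \<le> 1/2) sequentially"
      by eventually_elim (use b0 in \<open>simp add: field_simps\<close>)
    then have "(\<lambda>n. \<Prod>j<n. ?f j) \<longlonglongrightarrow> 0"
      using f_pos by (intro prod_tendsto_zero_of_eventually_le_half) 
    then have "(\<lambda>n. 2 powr s * (\<Prod>j<n. ?f j)) \<longlonglongrightarrow> 0" by (rule tendsto_mult_right_zero)
    also have "(\<lambda>n. 2 powr s * (\<Prod>j<n. ?f j)) = (\<lambda>n. S.words n * (2 / S.scale n) powr s)"
      by (simp add: prod_dividef S.words_def S.scale_eq_prod powr_divide prod_powr_distrib prod_nonneg mult.commute)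
    finally have "hausdorff_measure s S.support = 0" by (rule S.support_null[OF s])
    then show ?thesis unfolding dim_H_def using s by (intro Inf_lower) auto
  qed
  have lower: "\<alpha> \<le> s" if s: "0 \<le> s" and null: "hausdorff_measure s E = 0"
    and E: "E \<in> sets S.law" "emeasure S.law E = 1" for s E
  proof (rule ccontr)
    assume "\<not> \<alpha> \<le> s"
    then have s\<alpha>: "s < \<alpha>" by simp
    let ?f = "\<lambda>j. 6 * real (b (Suc j)) powr s / real (d (Suc j))"
    have f_pos: "0 < ?f n" for n using S.d_pos[of n] b0[of n] by simp
    have "eventually (\<lambda>n. 6 * real (b (Suc n)) powr s \<le> real (d (Suc n))) sequentially"
      using eventually_compose_filterlim[OF
          eventually_ln_ratio_greater[OF b_lim assms(5) s\<alpha> d_pos, of 6] filterlim_Suc]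
      by simp
    then have "eventually (\<lambda>n. ?f n \<le> 1) sequentially"
      by eventually_elim (use S.d_pos in \<open>simp add: field_simps\<close>)
    then obtain C where C: "0 < C" "\<And>n. (\<Prod>j<n. ?f j) \<le> C"
      using prod_bounded_of_eventually_le_one[of ?f] f_pos by metis
    have prod_f: "(\<Prod>j<n. ?f j) = 6 ^ n * S.scale n powr s / S.words n" for n
      by (simp add: prod_dividef prod.distrib S.words_def S.scale_eq_prod prod_powr_distrib prod_nonneg)
    have "6 ^ n * S.scale n powr s \<le> C * S.words n" for n
      using C(2)[of n, unfolded prod_f] S.words_pos[of n] by (simp add: pos_divide_le_eq)
    then have "measure S.law (cball x t) \<le> 5 * C * t powr s" if "0 < t" "t < 1" for x t
      using s s\<alpha> assms(2) that by (intro S.law_Frostman) auto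
    then have "emeasure S.law (cball x t) \<le> ennreal (5 * C * t powr s)" if "0 < t" "t < 1" for x t
      using that by (simp add: L.emeasure_eq_measure ennreal_leI)
    then have "emeasure S.law E = 0"
      using C(1) s E(1) null by (intro mass_distribution_principle[of S.law s "5 * C"]) auto
    with E(2) show False by simp
  qed
  show ?thesis
    unfolding S.riesz_product_eq_law
  proof (rule antisym)
    have "dim_H S.support \<le> ereal \<alpha>"
      by (rule ereal_le_epsilon2) (use upper in auto)
    moreover have "dim_H_measure S.law \<le> dim_H S.support"
      unfolding dim_H_measure_def using S.support_borel S.law_support by (intro Inf_lower) auto
    ultimately show "dim_H_measure S.law \<le> ereal \<alpha>" by (rule order_trans[rotated])
    show "ereal \<alpha> \<le> dim_H_measure S.law"
      unfolding dim_H_measure_def dim_H_def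
      using lower by (intro Inf_greatest) (auto intro!: Inf_greatest)
  qed
qed

end
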